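(* Let $\mathcal{I}$ be a finite parameter set and for every $\ell\in\mathbb{N}_0$ and $p\in\mathcal{I}$ let $A_\ell(p)$ be a real symmetric positive definite matrix. Let $c_0\in(0,1]$ be a constant and let the damping factor be $\omega(p)=\frac{c_0}{\rho(A_\ell(p))}$. Let $S_{\mathrm{Rich},\omega,\ell}(p)=\mathrm{Id}-\omega(p)A_\ell(p)$ be the iteration matrix of the damped Richardson method. Then $$\left\lVert A_\ell(p)\,S_{\mathrm{Rich},\omega,\ell}^{\nu}(p)\right\rVert_2\le \frac{1}{2c_0(\nu+1)}\,\lVert A_\ell(p)\rVert_2\qquad\text{for all }\nu\in\mathbb{N}$$ holds for all $p\in\mathcal{I}$ and $\ell\in\mathbb{N}_0$.
   Context: $\mathbb{N}=\{1,2,\dots\}$, $\mathbb{N}_0=\mathbb{N}\cup\{0\}$. $\rho(\cdot)$ is the spectral radius and $\lVert\cdot\rVert_2$ the spectral norm. $A_\ell(p)$ is the system matrix on the grid of level $\ell$ for parameter $p$. The damped Richardson method is the iteration $u_\ell^{j+1}(p)=u_\ell^j(p)+\omega(p)\,(f_\ell-A_\ell(p)u_\ell^j(p))$ with damping factor $\omega(p)\in(0,1]$; $S^\nu$ denotes the $\nu$-th power of the iteration matrix. *)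

theory Defs
  imports Complex_Main "Jordan_Normal_Form.Spectral_Radius"
begin

definition symmetric_mat :: "real mat \<Rightarrow> bool" where
  "symmetric_mat A \<longleftrightarrow> transpose_mat A = A"

definition pos_def_mat :: "real mat \<Rightarrow> bool" where
  "pos_def_mat A \<longleftrightarrow> square_mat A \<and>
     (\<forall>x \<in> carrier_vec (dim_row A). x \<noteq> 0\<^sub>v (dim_row A) \<longrightarrow> 0 < x \<bullet> (A *\<^sub>v x))"

definition vec_norm2 :: "real vec \<Rightarrow> real" where
  "vec_norm2 x = sqrt (x \<bullet> x)"

(* The operator norm induced by the Euclidean norm. The closed unit ball is never empty and its
   image is bounded, so this real supremum is always well defined. *)
definition spectral_norm :: "real mat \<Rightarrow> real" where
  "spectral_norm A =
     Sup {vec_norm2 (A *\<^sub>v x) | x. x \<in> carrier_vec (dim_col A) \<and> vec_norm2 x \<le> 1}"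

(* The library's spectral_radius is defined on complex matrices: eigenvalues of a real matrix
   are taken over the complex numbers. *)
definition real_spectral_radius :: "real mat \<Rightarrow> real" where
  "real_spectral_radius A = spectral_radius (map_mat complex_of_real A)"

(* The iteration u + omega (f - A u) has linear part Id - omega A. *)
definition richardson_mat :: "real \<Rightarrow> real mat \<Rightarrow> real mat" where
  "richardson_mat \<omega> A = 1\<^sub>m (dim_row A) - \<omega> \<cdot>\<^sub>m A"

end

theory Submission
  imports Defs
begin

text \<open>The iterates of a symmetric matrix have squared Euclidean norms forming a convex sequence,
  and these stay bounded when the spectral radius is less than one; hence the first step cannot
  increase the norm. By scaling, the Euclidean operator norm of a symmetric matrix is at most its
  spectral radius. Triangularising \<open>A\<close> over the complex numbers shows that the eigenvalues of
  \<open>A (Id - \<omega> A)\<^sup>\<nu>\<close> are \<open>\<lambda> (1 - \<omega> \<lambda>)\<^sup>\<nu>\<close> with \<open>\<lambda>\<close> an eigenvalue of \<open>A\<close>, and the claim reduces to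
  \<open>2 (\<nu> + 1) t (1 - t)\<^sup>\<nu> \<le> 1\<close> for \<open>t = \<omega> \<lambda> \<in> [0, 1]\<close>.\<close>

section \<open>Elementary real inequalities\<close>

lemma second_order_Bernoulli:
  fixes u :: real
  assumes "0 \<le> u"
  shows "1 + real n * u + real n * (real n - 1) / 2 * u\<^sup>2 \<le> (1 + u) ^ n"
proof (induction n)
  case (Suc n)
  have "0 \<le> real n * (real n - 1)" by (cases n) auto
  then have "0 \<le> real n * (real n - 1) / 2 * u ^ 3" using assms by simp
  then have "1 + real (Suc n) * u + real (Suc n) * (real (Suc n) - 1) / 2 * u\<^sup>2
      \<le> (1 + real n * u + real n * (real n - 1) / 2 * u\<^sup>2) * (1 + u)"
    by (simp add: field_simps power2_eq_square power3_eq_cube)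
  also have "\<dots> \<le> (1 + u) ^ n * (1 + u)"
    using Suc assms by (intro mult_right_mono) auto
  finally show ?case by (simp add: mult.commute)
qed simp

text \<open>With \<open>u = t / (1 - t)\<close> one has 1 - t = 1 / (1 + u), so t (1 - t)^n = u / (1
  + u)^(n + 1) and the claim becomes 2 (n + 1) u <= (1 + u)^(n + 1). The second-order Bernoulli
  bound at exponent n + 1 reduces this to the nonnegativity of a quadratic in u. At t = 1 the
  substitution breaks down, but there the left side vanishes because n >= 1.\<close>

lemma mult_power_one_minus_le:
  fixes t :: real
  assumes "0 \<le> t" "t \<le> 1" "1 \<le> n"
  shows "t * (1 - t) ^ n \<le> 1 / (2 * (real n + 1))"
proof (cases "t = 1")
  case True
  then show ?thesis using assms by (simp add: power_0_left)
next
  case False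
  define u where "u = t / (1 - t)"
  have u: "0 \<le> u" and pos: "1 - t > 0" and inv: "1 + u = 1 / (1 - t)"
    using assms False by (auto simp: u_def field_simps)
  \<comment> \<open>The quadratic \<open>1 - (n + 1) u + (n + 1) n u\<^sup>2 / 2\<close> has discriminant \<open>(n + 1) (1 - n) \<le> 0\<close>.\<close>
  have "0 \<le> (1 - (real n + 1) / 2 * u)\<^sup>2 + (real n + 1) * (real n - 1) / 4 * u\<^sup>2"
    using assms by simp
  then have "2 * (real n + 1) * u \<le> 1 + real (Suc n) * u + real (Suc n) * (real (Suc n) - 1) / 2 * u\<^sup>2"
    by (simp add: field_simps power2_eq_square)
  also have "\<dots> \<le> (1 + u) ^ Suc n" by (rule second_order_Bernoulli[OF u])
  also have "\<dots> = 1 / (1 - t) ^ Suc n" by (simp add: inv power_divide)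
  finally have "2 * (real n + 1) * u * (1 - t) ^ Suc n \<le> 1"
    using pos by (simp add: pos_le_divide_eq)
  moreover have "u * (1 - t) ^ Suc n = t * (1 - t) ^ n" using pos by (simp add: u_def)
  ultimately have "2 * (real n + 1) * (t * (1 - t) ^ n) \<le> 1" by (simp only: mult.assoc)
  then show ?thesis by (simp add: field_simps)
qed

text \<open>Convexity makes the increments nondecreasing, so a positive first increment would force
  at least linear growth and break the bound.\<close>

lemma convex_bounded_sequence_decreasing:
  fixes a :: "nat \<Rightarrow> real"
  assumes convex: "\<And>k. 2 * a (Suc k) \<le> a k + a (Suc (Suc k))" and bound: "\<And>k. a k \<le> C"
  shows "a 1 \<le> a 0"
proof (rule ccontr)
  assume "\<not> a 1 \<le> a 0"
  then have d: "0 < a 1 - a 0" by simp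
  have step: "a 1 - a 0 \<le> a (Suc k) - a k" for k
  proof (induction k)
    case (Suc k)
    then show ?case using convex[of k] by simp
  qed simp
  have growth: "a 0 + real k * (a 1 - a 0) \<le> a k" for k
  proof (induction k)
    case (Suc k)
    then show ?case using step[of k] by (simp add: algebra_simps)
  qed simp
  obtain k where "C - a 0 < real k * (a 1 - a 0)"
    using ex_less_of_nat_mult[OF d] by blast
  then show False using growth[of k] bound[of k] by simp
qed

section \<open>Euclidean vectors and matrix algebra\<close>

lemma scalar_prod_self_nonneg: "0 \<le> (x :: real vec) \<bullet> x"
  by (auto simp: scalar_prod_def intro!: sum_nonneg)

lemma scalar_prod_self_pos:
  fixes x :: "real vec"
  assumes "x \<in> carrier_vec n" "x \<noteq> 0\<^sub>v n"
  shows "0 < x \<bullet> x"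
proof -
  obtain i where i: "i < n" "x $ i \<noteq> 0" using assms by fastforce
  have "0 < (\<Sum>i = 0..<n. x $ i * x $ i)"
    using i by (intro sum_pos2[of _ i]) (auto simp: zero_less_mult_iff)
  then show ?thesis using assms by (simp add: scalar_prod_def)
qed

lemma two_scalar_prod_le:
  fixes x y :: "real vec"
  assumes "x \<in> carrier_vec n" "y \<in> carrier_vec n"
  shows "2 * (x \<bullet> y) \<le> x \<bullet> x + y \<bullet> y"
proof -
  have "2 * (\<Sum>i = 0..<n. x $ i * y $ i) \<le> (\<Sum>i = 0..<n. x $ i * x $ i) + (\<Sum>i = 0..<n. y $ i * y $ i)"
    unfolding sum_distrib_left sum.distrib[symmetric]
  proof (rule sum_mono)
    fix i
    show "2 * (x $ i * y $ i) \<le> x $ i * x $ i + y $ i * y $ i"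
      using zero_le_power2[of "x $ i - y $ i"] by (simp add: power2_eq_square algebra_simps)
  qed
  then show ?thesis using assms by (simp add: scalar_prod_def)
qed

lemma vec_norm2_nonneg: "0 \<le> vec_norm2 x"
  by (simp add: vec_norm2_def scalar_prod_self_nonneg)

lemma vec_norm2_smult: "vec_norm2 (c \<cdot>\<^sub>v x) = \<bar>c\<bar> * vec_norm2 x"
proof -
  have "(c \<cdot>\<^sub>v x) \<bullet> (c \<cdot>\<^sub>v x) = c\<^sup>2 * (x \<bullet> x)"
    by (simp add: power2_eq_square)
  then show ?thesis by (simp add: vec_norm2_def real_sqrt_mult)
qed

lemma smult_mat_mult_vec:
  fixes A :: "'a :: comm_semiring_0 mat"
  assumes "A \<in> carrier_mat nr nc" "v \<in> carrier_vec nc"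
  shows "(k \<cdot>\<^sub>m A) *\<^sub>v v = k \<cdot>\<^sub>v (A *\<^sub>v v)"
  using assms by (intro eq_vecI) (auto simp: scalar_prod_def sum_distrib_left mult.assoc)

lemma pow_mat_commute:
  fixes A :: "'a :: semiring_1 mat"
  assumes A: "A \<in> carrier_mat n n" and S: "S \<in> carrier_mat n n" and comm: "A * S = S * A"
  shows "A * S ^\<^sub>m k = S ^\<^sub>m k * A"
proof (induction k)
  case (Suc k)
  note Sk = pow_carrier_mat[OF S, of k]
  have "A * S ^\<^sub>m Suc k = S ^\<^sub>m k * A * S"
    using assoc_mult_mat[OF A Sk S] by (simp add: Suc)
  also have "\<dots> = S ^\<^sub>m Suc k * A"
    by (simp add: assoc_mult_mat[OF Sk A S] assoc_mult_mat[OF Sk S A] comm)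
  finally show ?case .
qed (use A S in simp)

lemma transpose_smult: "transpose_mat (k \<cdot>\<^sub>m A) = k \<cdot>\<^sub>m transpose_mat A"
  by (intro eq_matI) auto

lemma symmetric_mat_scalar_prod:
  assumes "A \<in> carrier_mat n n" "symmetric_mat A" "x \<in> carrier_vec n" "y \<in> carrier_vec n"
  shows "(A *\<^sub>v y) \<bullet> x = y \<bullet> (A *\<^sub>v x)"
  using transpose_vec_mult_scalar[of A n n x y] assms by (simp add: symmetric_mat_def)

section \<open>Operator norm of symmetric matrices\<close>

text \<open>This replaces an orthogonal diagonalisation: the convexity argument is applied to the
  squared norms of N^k x. The eigenvalue bound is strict because it is used to bound all powers of
  \<open>N\<close> uniformly, through the Jordan normal form; the non-strict case is recovered later
  by scaling.\<close>

lemma symmetric_mat_contraction: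
  assumes N: "N \<in> carrier_mat n n" and sym: "symmetric_mat N"
    and ev: "\<And>\<mu>. eigenvalue (map_mat complex_of_real N) \<mu> \<Longrightarrow> cmod \<mu> < 1"
    and x: "x \<in> carrier_vec n"
  shows "vec_norm2 (N *\<^sub>v x) \<le> vec_norm2 x"
\<comment> \<open>In dimension zero the spectrum is empty, so the spectral radius is not attained by
  any eigenvalue.\<close>
proof (cases "n = 0")
  case True
  then show ?thesis using N x by (simp add: vec_norm2_def scalar_prod_def)
next
  case False
  let ?N = "map_mat complex_of_real N"
  have cN: "?N \<in> carrier_mat n n" using N by simp
  \<comment> \<open>The maximum defining the spectral radius is attained, so the strict bound on
    each eigenvalue passes to it.\<close>
  have "spectral_radius ?N < 1"
    using spectral_radius_mem_max(1)[OF cN] False ev by (auto simp: spectrum_def)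
  then obtain C where C: "\<And>k. norm_bound (?N ^\<^sub>m k) C"
    using spectral_radius_jnf_norm_bound_less_1_upper_triangular[OF cN] by blast
  have pow: "N ^\<^sub>m k \<in> carrier_mat n n" for k using N by simp
  have entry: "\<bar>(N ^\<^sub>m k) $$ (i, j)\<bar> \<le> C" if "i < n" "j < n" for i j k
  proof -
    have "?N ^\<^sub>m k = map_mat complex_of_real (N ^\<^sub>m k)"
      by (rule of_real_hom.mat_hom_pow[OF N, symmetric])
    then show ?thesis using C[of k] that pow[of k] N by (auto simp: norm_bound_def)
  qed
  define w where "w k = N ^\<^sub>m k *\<^sub>v x" for k
  have w: "w k \<in> carrier_vec n" for k using pow[of k] x by (auto simp: w_def)
  \<comment> \<open>Matrix powers grow by a factor on the right, whereas the recursion needs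
    \<open>N\<close> on the left; the two agree because \<open>N\<close> commutes with its
    powers.\<close>
  have w_Suc: "w (Suc k) = N *\<^sub>v w k" for k
  proof -
    have "N ^\<^sub>m k * N = N * N ^\<^sub>m k" using pow_mat_commute[OF N N refl] by simp
    then show ?thesis by (simp add: w_def assoc_mult_mat_vec[OF N pow x])
  qed
  \<comment> \<open>A bound on every entry of every iterate, independent of both \<open>k\<close>
    and the row index, obtained from the entry bound \<open>C\<close> on the powers.\<close>
  define D where "D = (\<Sum>j = 0..<n. C * \<bar>x $ j\<bar>)"
  have w_entry: "\<bar>w k $ i\<bar> \<le> D" if "i < n" for i k
  proof -
    have "\<bar>w k $ i\<bar> = \<bar>\<Sum>j = 0..<n. (N ^\<^sub>m k) $$ (i, j) * x $ j\<bar>"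
      using that N x by (simp add: w_def scalar_prod_def)
    also have "\<dots> \<le> D"
      unfolding D_def
      by (rule order_trans[OF sum_abs], rule sum_mono)
        (use entry that in \<open>auto simp: abs_mult intro!: mult_right_mono\<close>)
    finally show ?thesis .
  qed
  have "w 1 \<bullet> w 1 \<le> w 0 \<bullet> w 0"
  proof (rule convex_bounded_sequence_decreasing[of "\<lambda>k. w k \<bullet> w k" "\<Sum>i = 0..<n. D\<^sup>2"])
    fix k
    \<comment> \<open>Symmetry moves one factor \<open>N\<close> across the scalar product; with 2
      x.y <= x.x + y.y this is exactly the convexity of the squared norms.\<close>
    have "w (Suc k) \<bullet> w (Suc k) = w k \<bullet> w (Suc (Suc k))"
      using symmetric_mat_scalar_prod[OF N sym w w, of k "Suc k"] by (simp add: w_Suc)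
    then show "2 * (w (Suc k) \<bullet> w (Suc k)) \<le> w k \<bullet> w k + w (Suc (Suc k)) \<bullet> w (Suc (Suc k))"
      using two_scalar_prod_le[OF w w, of k "Suc (Suc k)"] by simp
    have "w k \<bullet> w k = (\<Sum>i = 0..<n. (w k $ i)\<^sup>2)"
      using w[of k] by (simp add: scalar_prod_def power2_eq_square)
    also have "\<dots> \<le> (\<Sum>i = 0..<n. D\<^sup>2)"
    proof (rule sum_mono)
      fix i
      assume "i \<in> {0..<n}"
      then have "\<bar>w k $ i\<bar> \<le> \<bar>D\<bar>" using w_entry[of i k] by simp
      then show "(w k $ i)\<^sup>2 \<le> D\<^sup>2" by (simp only: abs_le_square_iff)
    qed
    finally show "w k \<bullet> w k \<le> (\<Sum>i = 0..<n. D\<^sup>2)" .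
  qed
  moreover have "w 0 = x" using N x by (simp add: w_def)
  moreover from this have "w 1 = N *\<^sub>v x" using w_Suc[of 0] by simp
  ultimately show ?thesis by (simp add: vec_norm2_def)
qed

text \<open>For any r > c the matrix M / r has all eigenvalues strictly inside the unit disc, so it
  is a contraction; then r tends to c.\<close>

lemma symmetric_mat_norm_le:
  assumes M: "M \<in> carrier_mat n n" and sym: "symmetric_mat M" and c: "0 \<le> c"
    and ev: "\<And>\<mu>. eigenvalue (map_mat complex_of_real M) \<mu> \<Longrightarrow> cmod \<mu> \<le> c"
    and x: "x \<in> carrier_vec n"
  shows "vec_norm2 (M *\<^sub>v x) \<le> c * vec_norm2 x"
proof -
  have le: "vec_norm2 (M *\<^sub>v x) \<le> r * vec_norm2 x" if r: "c < r" for r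
  proof -
    define N where "N = (1 / r) \<cdot>\<^sub>m M"
    have "0 < r" using c r by simp
    have N: "N \<in> carrier_mat n n" using M by (simp add: N_def)
    have cM: "map_mat complex_of_real M \<in> carrier_mat n n" using M by simp
    have cM_N: "map_mat complex_of_real M = complex_of_real r \<cdot>\<^sub>m map_mat complex_of_real N"
      using M \<open>0 < r\<close> by (intro eq_matI) (auto simp: N_def)
    have "symmetric_mat N"
      using sym by (simp add: symmetric_mat_def N_def transpose_smult)
    moreover have "cmod \<mu> < 1" if \<mu>: "eigenvalue (map_mat complex_of_real N) \<mu>" for \<mu>
    proof -
      obtain v where v: "v \<in> carrier_vec n" "v \<noteq> 0\<^sub>v n"
          and eq: "map_mat complex_of_real N *\<^sub>v v = \<mu> \<cdot>\<^sub>v v"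
        using \<mu> N unfolding eigenvalue_def eigenvector_def by auto
      have "map_mat complex_of_real M *\<^sub>v v = (complex_of_real r * \<mu>) \<cdot>\<^sub>v v"
        using N v by (simp add: cM_N smult_mat_mult_vec[of _ n n] eq smult_smult_assoc)
      then have "eigenvalue (map_mat complex_of_real M) (complex_of_real r * \<mu>)"
        using M v unfolding eigenvalue_def eigenvector_def by auto
      from ev[OF this] have "r * cmod \<mu> \<le> c" using \<open>0 < r\<close> by (simp add: norm_mult)
      then have "r * cmod \<mu> < r * 1" using r by linarith
      then show ?thesis using \<open>0 < r\<close> by (simp only: mult_less_cancel_left_pos)
    qed
    ultimately have "vec_norm2 (N *\<^sub>v x) \<le> vec_norm2 x"
      using symmetric_mat_contraction[OF N _ _ x] by blast
    moreover have "vec_norm2 (N *\<^sub>v x) = 1 / r * vec_norm2 (M *\<^sub>v x)"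
      using M x \<open>0 < r\<close> by (simp add: N_def smult_mat_mult_vec[of _ n n] vec_norm2_smult)
    ultimately show ?thesis using \<open>0 < r\<close> by (simp add: field_simps)
  qed
  show ?thesis
  proof (rule field_le_epsilon)
    fix e :: real
    assume e: "0 < e"
    have nn: "0 \<le> vec_norm2 x" by (rule vec_norm2_nonneg)
    \<comment> \<open>Here r = c + e / (|x| + 1): the added 1 keeps the denominator positive when
      \<open>x\<close> is zero, and the excess e |x| / (|x| + 1) stays below
      \<open>e\<close>.\<close>
    have "vec_norm2 (M *\<^sub>v x) \<le> (c + e / (vec_norm2 x + 1)) * vec_norm2 x"
      by (rule le) (use e nn in simp)
    also have "\<dots> \<le> c * vec_norm2 x + e"
      using e nn by (simp add: field_simps)
    finally show "vec_norm2 (M *\<^sub>v x) \<le> c * vec_norm2 x + e" .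
  qed
qed

lemma spectral_norm_le:
  assumes M: "M \<in> carrier_mat n n" and c: "0 \<le> c"
    and le: "\<And>x. x \<in> carrier_vec n \<Longrightarrow> vec_norm2 (M *\<^sub>v x) \<le> c * vec_norm2 x"
  shows "spectral_norm M \<le> c"
  unfolding spectral_norm_def
proof (rule cSup_least)
  have "0\<^sub>v n \<in> carrier_vec (dim_col M) \<and> vec_norm2 (0\<^sub>v n) \<le> 1"
    using M by (simp add: vec_norm2_def scalar_prod_def)
  then show "{vec_norm2 (M *\<^sub>v x) |x. x \<in> carrier_vec (dim_col M) \<and> vec_norm2 x \<le> 1} \<noteq> {}" by blast
  fix y
  assume "y \<in> {vec_norm2 (M *\<^sub>v x) |x. x \<in> carrier_vec (dim_col M) \<and> vec_norm2 x \<le> 1}"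
  then obtain x where x: "x \<in> carrier_vec n" "vec_norm2 x \<le> 1" "y = vec_norm2 (M *\<^sub>v x)"
    using M by auto
  then show "y \<le> c" using le[OF x(1)] mult_left_mono[OF x(2) c] by simp
qed

text \<open>The constant \<open>c\<close> does not enter the conclusion; it shows that the set under
  the supremum is bounded above, without which a real \<open>Sup\<close> need not be an upper
  bound.\<close>

lemma vec_norm2_le_spectral_norm:
  assumes M: "M \<in> carrier_mat n n" and c: "0 \<le> c"
    and le: "\<And>x. x \<in> carrier_vec n \<Longrightarrow> vec_norm2 (M *\<^sub>v x) \<le> c * vec_norm2 x"
    and x: "x \<in> carrier_vec n" "vec_norm2 x \<le> 1"
  shows "vec_norm2 (M *\<^sub>v x) \<le> spectral_norm M"
  unfolding spectral_norm_def
proof (rule cSup_upper)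
  show "vec_norm2 (M *\<^sub>v x) \<in> {vec_norm2 (M *\<^sub>v x) |x. x \<in> carrier_vec (dim_col M) \<and> vec_norm2 x \<le> 1}"
    using M x by auto
  show "bdd_above {vec_norm2 (M *\<^sub>v x) |x. x \<in> carrier_vec (dim_col M) \<and> vec_norm2 x \<le> 1}"
  proof (rule bdd_aboveI[of _ c])
    fix y
    assume "y \<in> {vec_norm2 (M *\<^sub>v x) |x. x \<in> carrier_vec (dim_col M) \<and> vec_norm2 x \<le> 1}"
    then obtain z where z: "z \<in> carrier_vec n" "vec_norm2 z \<le> 1" "y = vec_norm2 (M *\<^sub>v z)"
      using M by auto
    then show "y \<le> c" using le[OF z(1)] mult_left_mono[OF z(2) c] by simp
  qed
qed

section \<open>Eigenvalues of real symmetric and positive definite matrices\<close>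

text \<open>Split a complex eigenvector as v = a + i b. Comparing b.(A a) with (A b).a, which agree
  by symmetry, gives Im mu (a.a + b.b) = 0, and the second factor is positive.\<close>

lemma symmetric_mat_eigenvalue_real:
  assumes A: "A \<in> carrier_mat n n" and sym: "symmetric_mat A"
    and ev: "eigenvalue (map_mat complex_of_real A) \<mu>"
  obtains k where "\<mu> = complex_of_real k" "eigenvalue A k"
proof -
  obtain v where v: "v \<in> carrier_vec n" "v \<noteq> 0\<^sub>v n"
      and eq: "map_mat complex_of_real A *\<^sub>v v = \<mu> \<cdot>\<^sub>v v"
    using ev A unfolding eigenvalue_def eigenvector_def by auto
  define a b where "a = map_vec Re v" and "b = map_vec Im v"
  have a: "a \<in> carrier_vec n" and b: "b \<in> carrier_vec n" using v by (auto simp: a_def b_def)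
  have row: "(\<Sum>j = 0..<n. complex_of_real (A $$ (i, j)) * v $ j) = \<mu> * v $ i" if "i < n" for i
    using arg_cong[OF eq, of "\<lambda>w. w $ i"] that A v by (simp add: scalar_prod_def)
  have Aa: "A *\<^sub>v a = Re \<mu> \<cdot>\<^sub>v a - Im \<mu> \<cdot>\<^sub>v b"
  proof (rule eq_vecI)
    fix i
    assume "i < dim_vec (Re \<mu> \<cdot>\<^sub>v a - Im \<mu> \<cdot>\<^sub>v b)"
    then show "(A *\<^sub>v a) $ i = (Re \<mu> \<cdot>\<^sub>v a - Im \<mu> \<cdot>\<^sub>v b) $ i"
      using arg_cong[OF row, of i Re] A v by (simp add: a_def b_def scalar_prod_def)
  qed (use A b in auto)
  have Ab: "A *\<^sub>v b = Im \<mu> \<cdot>\<^sub>v a + Re \<mu> \<cdot>\<^sub>v b"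
  proof (rule eq_vecI)
    fix i
    assume "i < dim_vec (Im \<mu> \<cdot>\<^sub>v a + Re \<mu> \<cdot>\<^sub>v b)"
    then show "(A *\<^sub>v b) $ i = (Im \<mu> \<cdot>\<^sub>v a + Re \<mu> \<cdot>\<^sub>v b) $ i"
      using arg_cong[OF row, of i Im] A v by (simp add: a_def b_def scalar_prod_def add.commute)
  qed (use A b in auto)
  have ab: "a \<noteq> 0\<^sub>v n \<or> b \<noteq> 0\<^sub>v n"
  proof (rule ccontr)
    assume "\<not> ?thesis"
    then have zero: "a = 0\<^sub>v n" "b = 0\<^sub>v n" by auto
    have "v = 0\<^sub>v n"
    proof (rule eq_vecI)
      fix i
      assume "i < dim_vec (0\<^sub>v n)"
      then show "v $ i = 0\<^sub>v n $ i"
        using arg_cong[OF zero(1), of "\<lambda>w. w $ i"] arg_cong[OF zero(2), of "\<lambda>w. w $ i"] v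
        by (simp add: a_def b_def complex_eq_iff)
    qed (use v in auto)
    then show False using v by simp
  qed
  have "b \<bullet> (A *\<^sub>v a) = Re \<mu> * (b \<bullet> a) - Im \<mu> * (b \<bullet> b)"
    using a b by (simp add: Aa scalar_prod_minus_distrib[of _ n])
  moreover have "(A *\<^sub>v b) \<bullet> a = Im \<mu> * (a \<bullet> a) + Re \<mu> * (b \<bullet> a)"
    using a b by (simp add: Ab add_scalar_prod_distrib[of _ n])
  ultimately have "Im \<mu> * (a \<bullet> a + b \<bullet> b) = 0"
    using symmetric_mat_scalar_prod[OF A sym a b] by (simp add: algebra_simps)
  moreover have "0 < a \<bullet> a + b \<bullet> b"
    using ab scalar_prod_self_pos[OF a] scalar_prod_self_pos[OF b]
      scalar_prod_self_nonneg[of a] scalar_prod_self_nonneg[of b] by linarith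
  ultimately have Im: "Im \<mu> = 0" by simp
  \<comment> \<open>With the imaginary part gone, \<open>a\<close> and \<open>b\<close> each satisfy
    the real eigenvalue equation, so whichever is nonzero is a real eigenvector.\<close>
  have "A *\<^sub>v a = Re \<mu> \<cdot>\<^sub>v a" "A *\<^sub>v b = Re \<mu> \<cdot>\<^sub>v b"
    unfolding Aa Ab using a b Im by auto
  then have "eigenvalue A (Re \<mu>)"
    using ab a b A unfolding eigenvalue_def eigenvector_def by auto
  moreover have "\<mu> = complex_of_real (Re \<mu>)" using Im by (simp add: complex_eq_iff)
  ultimately show ?thesis using that by blast
qed

lemma pos_def_mat_eigenvalue_pos:
  assumes "pos_def_mat A" "eigenvalue A k"
  shows "0 < k"
proof -
  obtain v where v: "v \<in> carrier_vec (dim_row A)" "v \<noteq> 0\<^sub>v (dim_row A)" "A *\<^sub>v v = k \<cdot>\<^sub>v v"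
    using assms(2) unfolding eigenvalue_def eigenvector_def by blast
  have "0 < v \<bullet> (A *\<^sub>v v)" using assms(1) v(1,2) by (auto simp: pos_def_mat_def)
  then have "0 < k * (v \<bullet> v)" using v by simp
  then show ?thesis using scalar_prod_self_nonneg[of v] by (simp add: zero_less_mult_iff)
qed

section \<open>Eigenvalues through triangularisation\<close>

lemma upper_triangular_mult:
  fixes U V :: "'a :: semiring_0 mat"
  assumes U: "U \<in> carrier_mat n n" "upper_triangular U"
    and V: "V \<in> carrier_mat n n" "upper_triangular V"
  shows "upper_triangular (U * V)"
    and "\<And>i. i < n \<Longrightarrow> (U * V) $$ (i, i) = U $$ (i, i) * V $$ (i, i)"
proof -
  have entry: "(U * V) $$ (i, j) = (\<Sum>k = 0..<n. U $$ (i, k) * V $$ (k, j))"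
    if "i < n" "j < n" for i j
    using that U V by (simp add: scalar_prod_def)
  have zero: "U $$ (i, k) * V $$ (k, j) = 0" if "i < n" "k < n" "k < i \<or> j < k" for i j k
    using that U V by (auto simp: upper_triangular_def)
  show "upper_triangular (U * V)"
  proof (rule upper_triangularI)
    fix i j
    assume ij: "j < i" "i < dim_row (U * V)"
    then have "(\<Sum>k = 0..<n. U $$ (i, k) * V $$ (k, j)) = 0"
      using U by (intro sum.neutral ballI zero) auto
    then show "(U * V) $$ (i, j) = 0" using entry[of i j] ij U by simp
  qed
  fix i
  assume i: "i < n"
  \<comment> \<open>Terms with k < i vanish because of \<open>U\<close>, those with k > i because of
    \<open>V\<close>.\<close>
  have "(\<Sum>k = 0..<n. U $$ (i, k) * V $$ (k, i)) = (\<Sum>k\<in>{i}. U $$ (i, k) * V $$ (k, i))"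
    using i by (intro sum.mono_neutral_right ballI zero) auto
  then show "(U * V) $$ (i, i) = U $$ (i, i) * V $$ (i, i)" using entry[OF i i] by simp
qed

lemma upper_triangular_pow:
  fixes U :: "'a :: semiring_1 mat"
  assumes U: "U \<in> carrier_mat n n" "upper_triangular U"
  shows "upper_triangular (U ^\<^sub>m k) \<and> (\<forall>i < n. (U ^\<^sub>m k) $$ (i, i) = (U $$ (i, i)) ^ k)"
proof (induction k)
  case (Suc k)
  then show ?case
    using upper_triangular_mult[OF pow_carrier_mat[OF U(1), of k] _ U] by (simp add: power_commutes)
qed (use U in simp)

lemma upper_triangular_eigenvalue_iff:
  fixes U :: "'a :: field mat"
  assumes "U \<in> carrier_mat n n" "upper_triangular U"
  shows "eigenvalue U \<mu> \<longleftrightarrow> (\<exists>i < n. \<mu> = U $$ (i, i))"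
proof -
  have "poly (prod_list (map (\<lambda>a. [:- a, 1:]) xs)) \<mu> = 0 \<longleftrightarrow> \<mu> \<in> set xs" for xs :: "'a list"
    by (induction xs) auto
  then have "eigenvalue U \<mu> \<longleftrightarrow> \<mu> \<in> set (diag_mat U)"
    using assms by (simp add: eigenvalue_root_char_poly char_poly_upper_triangular)
  then show ?thesis using assms by (auto simp: diag_mat_def)
qed

lemma similar_mat_eigenvalue_iff:
  fixes A B :: "'a :: field mat"
  assumes "A \<in> carrier_mat n n" "B \<in> carrier_mat n n" "similar_mat A B"
  shows "eigenvalue A \<mu> \<longleftrightarrow> eigenvalue B \<mu>"
  using assms by (simp add: eigenvalue_root_char_poly[of _ n] char_poly_similar)

text \<open>The witnesses \<open>P\<close> and \<open>Q\<close> are kept explicit, since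
  similarities of two factors combine to one of their product only when both use the same change of
  basis.\<close>

lemma similar_mat_wit_one_minus:
  fixes A B :: "'a :: comm_ring_1 mat"
  assumes A: "A \<in> carrier_mat n n" and wit: "similar_mat_wit A B P Q"
  shows "similar_mat_wit (1\<^sub>m n - A) (1\<^sub>m n - B) P Q"
proof -
  note w = similar_mat_witD2[OF A wit]
  have "P * (1\<^sub>m n - B) * Q = (P - P * B) * Q"
    using w(5,6) by (simp add: mult_minus_distrib_mat[of _ n n _ n])
  also have "\<dots> = 1\<^sub>m n - A"
    using w(1,3,5-7) by (simp add: minus_mult_distrib_mat[of _ n n _ _ n])
  finally show ?thesis using w by (intro similar_mat_witI[of P Q n]) auto
qed

lemma similar_mat_wit_mult:
  fixes A B :: "'a :: comm_ring_1 mat"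
  assumes A: "A \<in> carrier_mat n n" and A': "A' \<in> carrier_mat n n"
    and wit: "similar_mat_wit A B P Q" and wit': "similar_mat_wit A' B' P Q"
  shows "similar_mat_wit (A * A') (B * B') P Q"
proof -
  note w = similar_mat_witD2[OF A wit] and w' = similar_mat_witD2[OF A' wit']
  have "A * A' = P * (B * (Q * P) * B') * Q"
    unfolding w(3) w'(3) using w(5-7) w'(5) by (simp add: assoc_mult_mat[of _ n n _ n _ n])
  also have "\<dots> = P * (B * B') * Q" using w(2,5) by simp
  finally show ?thesis using w w' by (intro similar_mat_witI[of P Q n]) auto
qed

text \<open>Over the complex numbers the characteristic polynomial splits, so a Schur decomposition
  makes \<open>A\<close> similar to a triangular \<open>B\<close>. The same change of basis carries
  the whole expression to a triangular matrix whose diagonal entries are b (1 - omega b)^nu, with b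
  running over the diagonal of \<open>B\<close>.\<close>

lemma eigenvalue_mult_pow_one_minus:
  fixes A :: "complex mat"
  assumes A: "A \<in> carrier_mat n n"
    and ev: "eigenvalue (A * (1\<^sub>m n - \<omega> \<cdot>\<^sub>m A) ^\<^sub>m \<nu>) \<mu>"
  obtains k where "eigenvalue A k" "\<mu> = k * (1 - \<omega> * k) ^ \<nu>"
proof -
  obtain B where B: "B \<in> carrier_mat n n" "upper_triangular B" "similar_mat A B"
    using char_poly_factorized[OF A] schur_decomposition_exists[OF A] by blast
  then obtain P Q where wit: "similar_mat_wit A B P Q" unfolding similar_mat_def by blast
  let ?S = "1\<^sub>m n - \<omega> \<cdot>\<^sub>m A" and ?T = "1\<^sub>m n - \<omega> \<cdot>\<^sub>m B"
  have S: "?S \<in> carrier_mat n n" using A by (intro minus_carrier_mat smult_carrier_mat)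
  have T: "?T \<in> carrier_mat n n" "upper_triangular ?T"
    using B by (auto simp: upper_triangular_def)
  have "similar_mat_wit (?S ^\<^sub>m \<nu>) (?T ^\<^sub>m \<nu>) P Q"
    using A by (intro similar_mat_wit_pow similar_mat_wit_one_minus similar_mat_wit_smult wit) simp
  then have "similar_mat (A * ?S ^\<^sub>m \<nu>) (B * ?T ^\<^sub>m \<nu>)"
    using similar_mat_wit_mult[OF A pow_carrier_mat[OF S] wit] unfolding similar_mat_def by blast
  then have "eigenvalue (B * ?T ^\<^sub>m \<nu>) \<mu>"
    using ev similar_mat_eigenvalue_iff[of "A * ?S ^\<^sub>m \<nu>" n "B * ?T ^\<^sub>m \<nu>"] A B S T by simp
  moreover note Tpow = upper_triangular_pow[OF T, of \<nu>]
  moreover note prod = upper_triangular_mult[OF B(1,2) pow_carrier_mat[OF T(1), of \<nu>]]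
  ultimately obtain i where i: "i < n" "\<mu> = B $$ (i, i) * (?T $$ (i, i)) ^ \<nu>"
    using upper_triangular_eigenvalue_iff[of "B * ?T ^\<^sub>m \<nu>" n \<mu>] B T by auto
  have "eigenvalue A (B $$ (i, i))"
    using i(1) upper_triangular_eigenvalue_iff[OF B(1,2)] similar_mat_eigenvalue_iff[OF A B(1,3)]
    by blast
  moreover have "\<mu> = B $$ (i, i) * (1 - \<omega> * B $$ (i, i)) ^ \<nu>" using i B by simp
  ultimately show ?thesis using that by blast
qed

text \<open>Transposition reverses the product of two symmetric factors, and these factors commute
  because the second is a polynomial in \<open>A\<close>.\<close>

lemma symmetric_mat_mult_pow_one_minus:
  assumes A: "A \<in> carrier_mat n n" and sym: "symmetric_mat A"
  shows "symmetric_mat (A * (1\<^sub>m n - \<omega> \<cdot>\<^sub>m A) ^\<^sub>m \<nu>)"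
proof -
  let ?S = "1\<^sub>m n - \<omega> \<cdot>\<^sub>m A"
  have S: "?S \<in> carrier_mat n n" using A by (intro minus_carrier_mat smult_carrier_mat)
  note Sk = pow_carrier_mat[OF S]
  have S_sym: "transpose_mat ?S = ?S"
    using A sym by (simp add: transpose_minus[of _ n n] transpose_smult symmetric_mat_def)
  have "A * ?S = A - \<omega> \<cdot>\<^sub>m (A * A)"
    using A by (subst mult_minus_distrib_mat[of _ n n _ n])
      (auto simp: mult_smult_distrib[of _ n n _ n])
  also have "\<dots> = ?S * A"
    using A by (subst minus_mult_distrib_mat[of _ n n _ _ n])
      (auto simp: mult_smult_assoc_mat[of _ n n _ n])
  finally have ASk: "A * ?S ^\<^sub>m \<nu> = ?S ^\<^sub>m \<nu> * A" by (rule pow_mat_commute[OF A S])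
  have "transpose_mat (?S ^\<^sub>m k) = ?S ^\<^sub>m k" for k
  proof (induction k)
    case (Suc k)
    then show ?case using transpose_mult[OF Sk[of k] S] S_sym pow_mat_commute[OF S S refl, of k] by simp
  qed (use A in simp)
  then show ?thesis
    using transpose_mult[OF A Sk[of \<nu>]] sym by (simp add: symmetric_mat_def ASk[symmetric])
qed

lemma cmod_eigenvalue_le_real_spectral_radius:
  assumes A: "A \<in> carrier_mat n n"
    and ev: "eigenvalue (map_mat complex_of_real A) \<mu>"
  shows "cmod \<mu> \<le> real_spectral_radius A"
proof -
  have cA: "map_mat complex_of_real A \<in> carrier_mat n n" using A by simp
  show ?thesis
    unfolding real_spectral_radius_def
    by (rule spectral_radius_mem_max(2)[OF cA eigenvalue_imp_nonzero_dim[OF cA ev]])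
      (use ev in \<open>simp add: spectrum_def\<close>)
qed

section \<open>The smoothing estimate for a single matrix\<close>

lemma richardson_smoothing:
  fixes A :: "real mat"
  assumes sym: "symmetric_mat A" and pd: "pos_def_mat A" and c: "0 < c" "c \<le> 1" and \<nu>: "1 \<le> \<nu>"
  shows "spectral_norm (A * richardson_mat (c / real_spectral_radius A) A ^\<^sub>m \<nu>)
    \<le> 1 / (2 * c * (real \<nu> + 1)) * spectral_norm A"
proof -
  define n where "n = dim_row A"
  have A: "A \<in> carrier_mat n n" using pd by (auto simp: n_def pos_def_mat_def)
  let ?A = "map_mat complex_of_real A"
  define \<rho> where "\<rho> = real_spectral_radius A"
  define \<omega> where "\<omega> = c / \<rho>"
  define K where "K = 1 / (2 * c * (real \<nu> + 1))"
  define M where "M = A * (1\<^sub>m n - \<omega> \<cdot>\<^sub>m A) ^\<^sub>m \<nu>"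
  have cA: "?A \<in> carrier_mat n n" using A by simp
  have S: "1\<^sub>m n - \<omega> \<cdot>\<^sub>m A \<in> carrier_mat n n" using A by (intro minus_carrier_mat smult_carrier_mat)
  have M: "M \<in> carrier_mat n n"
    unfolding M_def by (rule mult_carrier_mat[OF A pow_carrier_mat[OF S]])
  have K: "0 \<le> K" using c by (simp add: K_def)
  \<comment> \<open>Some operator bound is needed before the supremum in
    \<open>spectral_norm A\<close> can be used. The maximum with 0 guarantees nonnegativity even in
    dimension zero, where the spectral radius is the \<open>Max\<close> of an empty set.\<close>
  obtain d where d: "0 \<le> d" and A_le: "\<And>x. x \<in> carrier_vec n \<Longrightarrow> vec_norm2 (A *\<^sub>v x) \<le> d * vec_norm2 x"
  proof
    show "vec_norm2 (A *\<^sub>v x) \<le> max 0 \<rho> * vec_norm2 x" if "x \<in> carrier_vec n" for x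
      using cmod_eigenvalue_le_real_spectral_radius[OF A]
      by (intro symmetric_mat_norm_le[OF A sym _ _ that]) (auto simp: \<rho>_def le_max_iff_disj)
  qed simp
  have norm_A: "vec_norm2 (A *\<^sub>v x) \<le> spectral_norm A"
    if "x \<in> carrier_vec n" "vec_norm2 x \<le> 1" for x
    using that by (intro vec_norm2_le_spectral_norm[OF A d A_le])
  \<comment> \<open>A normalised eigenvector x gives k <= |k| = |A x|, which is one of the values
    under the supremum.\<close>
  have ev_le: "k \<le> spectral_norm A" if k: "eigenvalue A k" for k
  proof -
    obtain v where v: "v \<in> carrier_vec n" "v \<noteq> 0\<^sub>v n" "A *\<^sub>v v = k \<cdot>\<^sub>v v"
      using k A unfolding eigenvalue_def eigenvector_def by auto
    have pos: "0 < vec_norm2 v" using scalar_prod_self_pos[OF v(1,2)] by (simp add: vec_norm2_def)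
    define x where "x = (1 / vec_norm2 v) \<cdot>\<^sub>v v"
    have x: "x \<in> carrier_vec n" "vec_norm2 x = 1" using v pos by (auto simp: x_def vec_norm2_smult)
    have "A *\<^sub>v x = k \<cdot>\<^sub>v x"
      using A v by (simp add: x_def mult_mat_vec[of _ n n] smult_smult_assoc mult.commute)
    then show ?thesis using norm_A[OF x(1)] x(2) by (simp add: vec_norm2_smult)
  qed
  have nonneg: "0 \<le> spectral_norm A"
    using norm_A[of "0\<^sub>v n"] vec_norm2_nonneg[of "A *\<^sub>v 0\<^sub>v n"]
    by (simp add: vec_norm2_def scalar_prod_def)
  have M_ev: "cmod \<mu> \<le> K * spectral_norm A" if \<mu>: "eigenvalue (map_mat complex_of_real M) \<mu>" for \<mu>
  proof -
    have "map_mat complex_of_real (1\<^sub>m n - \<omega> \<cdot>\<^sub>m A) = 1\<^sub>m n - complex_of_real \<omega> \<cdot>\<^sub>m ?A"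
      using A by (intro eq_matI) auto
    then have "map_mat complex_of_real M = ?A * (1\<^sub>m n - complex_of_real \<omega> \<cdot>\<^sub>m ?A) ^\<^sub>m \<nu>"
      by (simp add: M_def of_real_hom.mat_hom_mult[OF A pow_carrier_mat[OF S]]
        of_real_hom.mat_hom_pow[OF S])
    then obtain \<kappa> where \<kappa>: "eigenvalue ?A \<kappa>" "\<mu> = \<kappa> * (1 - complex_of_real \<omega> * \<kappa>) ^ \<nu>"
      using \<mu> eigenvalue_mult_pow_one_minus[OF cA] by metis
    obtain k where k: "\<kappa> = complex_of_real k" "eigenvalue A k"
      using symmetric_mat_eigenvalue_real[OF A sym \<kappa>(1)] .
    have k_pos: "0 < k" by (rule pos_def_mat_eigenvalue_pos[OF pd k(2)])
    have k_le: "k \<le> \<rho>" using cmod_eigenvalue_le_real_spectral_radius[OF A \<kappa>(1)] k_pos by (simp add: k(1) \<rho>_def)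
    \<comment> \<open>Positivity comes from the eigenvalue at hand, so the quotient defining the
      damping factor is genuine here. In dimension zero there is no eigenvalue to treat.\<close>
    then have \<rho>_pos: "0 < \<rho>" using k_pos by simp
    \<comment> \<open>The spectral radius is the modulus of some eigenvalue; that eigenvalue is real
      and positive, hence equals the spectral radius, and \<open>ev_le\<close> applies to
      it.\<close>
    have \<rho>_norm: "\<rho> \<le> spectral_norm A"
    proof -
      obtain \<kappa>' where \<kappa>': "eigenvalue ?A \<kappa>'" "\<rho> = cmod \<kappa>'"
        using spectral_radius_mem_max(1)[OF cA eigenvalue_imp_nonzero_dim[OF cA \<kappa>(1)]]
        by (auto simp: \<rho>_def real_spectral_radius_def spectrum_def)
      obtain k' where k': "\<kappa>' = complex_of_real k'" "eigenvalue A k'"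
        using symmetric_mat_eigenvalue_real[OF A sym \<kappa>'(1)] .
      show ?thesis
        using ev_le[OF k'(2)] pos_def_mat_eigenvalue_pos[OF pd k'(2)] by (simp add: \<kappa>'(2) k'(1))
    qed
    define t where "t = \<omega> * k"
    have "t \<le> c" using k_pos k_le \<rho>_pos c by (simp add: t_def \<omega>_def field_simps)
    then have "t \<le> 1" using c by linarith
    moreover have "0 \<le> t" using k_pos \<rho>_pos c by (simp add: t_def \<omega>_def)
    ultimately have t: "0 \<le> t" "t \<le> 1" by auto
    have "\<mu> = complex_of_real (k * (1 - t) ^ \<nu>)" by (simp add: \<kappa>(2) k(1) t_def)
    then have "cmod \<mu> = k * (1 - t) ^ \<nu>"
      using k_pos t by (simp only: norm_of_real abs_of_nonneg mult_nonneg_nonneg less_imp_le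
        zero_le_power diff_ge_0_iff_ge)
    \<comment> \<open>Since t = c k / rho, one has k = (rho / c) t; this is the source of the factor
      1 / c in \<open>K\<close>.\<close>
    also have "\<dots> = \<rho> / c * (t * (1 - t) ^ \<nu>)" using \<rho>_pos c by (simp add: t_def \<omega>_def)
    also have "\<dots> \<le> \<rho> / c * (1 / (2 * (real \<nu> + 1)))"
      using \<rho>_pos c by (intro mult_left_mono mult_power_one_minus_le t \<nu>) auto
    also have "\<dots> = K * \<rho>" by (simp add: K_def)
    also have "\<dots> \<le> K * spectral_norm A" using \<rho>_norm K by (rule mult_left_mono)
    finally show ?thesis .
  qed
  have "symmetric_mat M" unfolding M_def by (rule symmetric_mat_mult_pow_one_minus[OF A sym])
  then have "spectral_norm M \<le> K * spectral_norm A"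
    using M_ev K nonneg by (intro spectral_norm_le[OF M] symmetric_mat_norm_le[OF M]) auto
  then show ?thesis
    by (simp add: M_def K_def \<omega>_def \<rho>_def richardson_mat_def n_def)
qed

theorem theorem3p5:
  fixes I :: "'p set"
    and A :: "nat \<Rightarrow> 'p \<Rightarrow> real mat"
    and c\<^sub>0 :: real
    and \<omega> :: "nat \<Rightarrow> 'p \<Rightarrow> real"
  assumes "finite I"
    and "\<And>l p. p \<in> I \<Longrightarrow> symmetric_mat (A l p)"
    and "\<And>l p. p \<in> I \<Longrightarrow> pos_def_mat (A l p)"
    and "0 < c\<^sub>0" and "c\<^sub>0 \<le> 1"
    and "\<And>l p. p \<in> I \<Longrightarrow> \<omega> l p = c\<^sub>0 / real_spectral_radius (A l p)"
  shows "\<forall>p \<in> I. \<forall>l. \<forall>\<nu>::nat. 1 \<le> \<nu> \<longrightarrow>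
           spectral_norm (A l p * richardson_mat (\<omega> l p) (A l p) ^\<^sub>m \<nu>)
             \<le> 1 / (2 * c\<^sub>0 * (real \<nu> + 1)) * spectral_norm (A l p)"
  using assms richardson_smoothing by simp

end
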